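(* Let $\varepsilon>0$, let $t\ge 3$ be odd, and let $n,k$ be positive integers with $t=n-2k+2$ and $n\ge t^3/\varepsilon$. Then $$1-\varepsilon<\chi(SG(n,k))-\chi_c(SG(n,k))<1.$$
   Context: The Schrijver graph $SG(n,k)$ has as vertices the $k$-element subsets of $\{1,\dots,n\}$ containing no two cyclically consecutive elements (no $\{i,i+1\}$ for $1\le i<n$, and not $\{1,n\}$); two vertices are adjacent iff disjoint. $\chi$ is the chromatic number. Circular chromatic number: for positive integers $p,q$ a map $c:V(G)\to\{1,\dots,p\}$ is a $(p,q)$-coloring if $q\le|c(u)-c(v)|\le p-q$ for adjacent $u,v$; $\chi_c(G)=\inf\{p/q: G$ has a $(p,q)$-coloring$\}$. *)

theory Defs
  imports Complex_Main "Graph_Theory.Pair_Digraph"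
begin

text \<open>
  Simple graphs are the loop-free symmetric pair digraphs of the library: \<^term>\<open>pverts G\<close>
  is the vertex set, and an edge between \<open>u\<close> and \<open>v\<close> is the pair of arcs
  \<open>(u, v)\<close> and \<open>(v, u)\<close> in \<^term>\<open>parcs G\<close>.
\<close>

definition proper_coloring :: "'a pair_pre_digraph \<Rightarrow> nat \<Rightarrow> ('a \<Rightarrow> nat) \<Rightarrow> bool" where
  "proper_coloring G m c \<longleftrightarrow>
     (\<forall>v \<in> pverts G. c v \<in> {1..m}) \<and> (\<forall>(u, v) \<in> parcs G. c u \<noteq> c v)"

text \<open>
  As a \<open>LEAST\<close> over the naturals this is meaningful only for graphs that have a finite proper
  coloring, in particular for finite simple graphs.
\<close>

definition chromatic_number :: "'a pair_pre_digraph \<Rightarrow> nat" where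
  "chromatic_number G = (LEAST m. \<exists>c. proper_coloring G m c)"

text \<open>Differences of colors and \<open>p - q\<close> are taken in the integers, not truncated.\<close>

definition pq_coloring :: "'a pair_pre_digraph \<Rightarrow> nat \<Rightarrow> nat \<Rightarrow> ('a \<Rightarrow> nat) \<Rightarrow> bool" where
  "pq_coloring G p q c \<longleftrightarrow>
     (\<forall>v \<in> pverts G. c v \<in> {1..p}) \<and>
     (\<forall>(u, v) \<in> parcs G.
        int q \<le> \<bar>int (c u) - int (c v)\<bar> \<and> \<bar>int (c u) - int (c v)\<bar> \<le> int p - int q)"

text \<open>
  The set is bounded below by 0, and nonempty for finite simple graphs, so that the real-valued
  \<^term>\<open>Inf\<close> is the genuine infimum there.
\<close>

definition circular_chromatic_number :: "'a pair_pre_digraph \<Rightarrow> real" where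
  "circular_chromatic_number G =
     Inf {real p / real q | p q. p > 0 \<and> q > 0 \<and> (\<exists>c. pq_coloring G p q c)}"

definition schrijver_vertices :: "nat \<Rightarrow> nat \<Rightarrow> nat set set" where
  "schrijver_vertices n k =
     {S. S \<subseteq> {1..n} \<and> card S = k \<and>
         (\<forall>i. 1 \<le> i \<and> i < n \<longrightarrow> \<not> {i, i + 1} \<subseteq> S) \<and> \<not> {1, n} \<subseteq> S}"

definition schrijver_graph :: "nat \<Rightarrow> nat \<Rightarrow> nat set pair_pre_digraph" where
  "schrijver_graph n k =
     \<lparr> pverts = schrijver_vertices n k,
       parcs = {(S, T). S \<in> schrijver_vertices n k \<and> T \<in> schrijver_vertices n k \<and> S \<inter> T = {}} \<rparr>"

text \<open>Positivity of \<open>k\<close> excludes the empty set, which would be disjoint from itself.\<close>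

lemma pair_graph_schrijver_graph:
  assumes "k > 0"
  shows "pair_graph (schrijver_graph n k)"
proof -
  let ?V = "schrijver_vertices n k"
  have V: "finite ?V"
    by (rule finite_subset[of _ "Pow {1..n}"]) (auto simp: schrijver_vertices_def)
  have E: "finite {(S, T). S \<in> ?V \<and> T \<in> ?V \<and> S \<inter> T = {}}"
    by (rule finite_subset[of _ "?V \<times> ?V"]) (use V in auto)
  have ne: "S \<noteq> {}" if "S \<in> ?V" for S
    using that assms by (auto simp: schrijver_vertices_def)
  show ?thesis
    by unfold_locales
      (use V E ne in \<open>auto simp: schrijver_graph_def symmetric_def sym_def arcs_ends_def
         arc_to_ends_def intro!: symI\<close>)
qed

end

(* Away from the single vertex B = {t, t + 2, ..., n}, the minimum of S is a proper coloring with the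
   t - 1 colors 1, ..., t - 1. Disjoint S and S' meet B in almost complementary parts, so
   |S \<inter> B| tells how far along an alternating walk S lies from B. Letting the odd and the even color
   classes drift by one unit on a circle of length t - 1 as |S \<inter> B| varies, they pair up near B
   (here t - 1 must be even), which frees a place for B at the cost of an arbitrarily small
   enlargement of the circle.

   That t colors are needed follows from Tucker's lemma on the octahedral sphere, proved by the parity
   argument of Fan: chains of signed sets are signed permutations, and facets are shared along
   adjacent transpositions and sign changes of the last entry. The labels are the length of a longest
   alternating subsequence and, once both sides contain a vertex, the largest color used in them.

   A circular coloring with ratio close to t - 1 yields a proper coloring with t - 1 colors, by
   cutting the circle at a place free of vertices; hence the difference is strictly below 1. *)

theory Submission
  imports Defs "HOL-Library.Disjoint_Sets" "HOL-Library.Multiset" "HOL-Library.Z2"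
begin

section \<open>Involutions and parity\<close>

lemma even_card_involution:
  assumes "\<And>x. x \<in> X \<Longrightarrow> h x \<in> X" "\<And>x. x \<in> X \<Longrightarrow> h (h x) = x" "\<And>x. x \<in> X \<Longrightarrow> h x \<noteq> x"
  shows "even (card X)"
proof -
  \<comment> \<open>Over the two-element field the ones cancel in pairs \<open>x\<close>,
    \<open>h x\<close>.\<close>
  have "(\<Sum>x\<in>X. 1 :: bit) = 0"
    by (rule sum_involution_eq_0[of X _ h]) (use assms in auto)
  moreover have "(of_nat m :: bit) = 0 \<longleftrightarrow> even m" for m
    by (induction m) auto
  ultimately show ?thesis
    by simp
qed

subsection \<open>Alternating lists\<close>

fun alternating :: "('a \<Rightarrow> bool) \<Rightarrow> bool \<Rightarrow> 'a list \<Rightarrow> bool" where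
  "alternating P s [] \<longleftrightarrow> True"
| "alternating P s (x # xs) \<longleftrightarrow> P x = s \<and> alternating P (\<not> s) xs"

lemma alternating_nth:
  "alternating P s xs \<longleftrightarrow> (\<forall>i<length xs. P (xs ! i) = (even i = s))"
proof (induction xs arbitrary: s)
  case (Cons x xs)
  show ?case
    unfolding alternating.simps Cons.IH length_Cons All_less_Suc2 nth_Cons_0 nth_Cons_Suc even_Suc
    by auto
qed simp

lemma alternating_map: "alternating P s (map f xs) \<longleftrightarrow> alternating (P \<circ> f) s xs"
  by (simp add: alternating_nth)

lemma alternating_cong:
  "(\<And>x. x \<in> set xs \<Longrightarrow> P x \<longleftrightarrow> Q x) \<Longrightarrow> alternating P s xs \<longleftrightarrow> alternating Q s xs"
  by (auto simp: alternating_nth)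

lemma alternating_neg: "alternating (\<lambda>x. \<not> P x) s xs \<longleftrightarrow> alternating P (\<not> s) xs"
  by (auto simp: alternating_nth)

text \<open>If \<open>x = b\<close>, sortedness makes \<open>bs\<close> begin with \<open>b\<close>
  too, and deleting either copy leaves the same list. This lets the count of removals recurse on the
  tail.\<close>

lemma remove1_Cons_sorted:
  assumes "sorted (b # bs)" "x \<in> set bs"
  shows "remove1 x (b # bs) = b # remove1 x bs"
proof (cases "x = b")
  case True
  with assms obtain cs where "bs = b # cs"
    by (cases bs) force+
  with True show ?thesis
    by simp
qed simp

text \<open>The local step of Fan's argument. Removing the head is good if the tail alternates from
  \<open>s\<close>; the other good removals exist only if \<open>P b = s\<close>, and the induction
  hypothesis gives their parity.\<close>

lemma odd_alternating_removals:
  assumes "sorted xs" "xs \<noteq> []"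
  shows "odd (length (filter (\<lambda>x. alternating P s (remove1 x xs)) xs)) \<longleftrightarrow>
         alternating P s xs \<or> alternating P (\<not> s) xs"
  using assms
proof (induction xs arbitrary: s)
  case (Cons b bs)
  let ?C = "\<lambda>s. length (filter (\<lambda>x. alternating P s (remove1 x bs)) bs)"
  have tail: "filter (\<lambda>x. alternating P s (remove1 x (b # bs))) bs =
      (if P b = s then filter (\<lambda>x. alternating P (\<not> s) (remove1 x bs)) bs else [])"
    using remove1_Cons_sorted[OF Cons.prems(1)]
    by (auto intro: filter_cong simp: filter_empty_conv simp del: remove1.simps)
  have count: "length (filter (\<lambda>x. alternating P s (remove1 x (b # bs))) (b # bs)) =
      (if alternating P s bs then 1 else 0) + (if P b = s then ?C (\<not> s) else 0)"
    unfolding filter.simps(2) tail by simp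
  show ?case
  proof (cases "bs = []")
    case True
    then show ?thesis
      by (simp del: remove1.simps add: count) auto
  next
    case False
    \<comment> \<open>If \<open>P b = s\<close>, a tail alternating from \<open>s\<close>
      contributes to both summands and cancels; by exclusivity only tails alternating from
      \<open>\<not> s\<close> remain.\<close>
    have excl: "\<not> (alternating P s bs \<and> alternating P (\<not> s) bs)"
      using False by (cases bs) auto
    have IH: "odd (?C (\<not> s)) \<longleftrightarrow> alternating P s bs \<or> alternating P (\<not> s) bs"
      using Cons.IH[of "\<not> s"] Cons.prems False by auto
    show ?thesis
      unfolding count using IH excl by auto
  qed
qed simp

subsection \<open>Tucker's lemma on the octahedral sphere\<close>

text \<open>Nonzero sign vectors, the vertices of the barycentric subdivision of the octahedral
  sphere. Disjointness from the negation also excludes 0.\<close>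

definition signed_sets :: "nat \<Rightarrow> int set set" where
  "signed_sets n = {X. X \<noteq> {} \<and> X \<subseteq> {- int n..int n} \<and> X \<inter> uminus ` X = {}}"

text \<open>The prefixes of such a list form a maximal chain of signed sets, so the lists encode the
  simplices of top dimension.\<close>

definition signed_perms :: "nat \<Rightarrow> int list set" where
  "signed_perms n = {L. distinct (map abs L) \<and> abs ` set L = {1..int n}}"

text \<open>The upper hemisphere, whose boundary is the sphere one dimension lower.\<close>

definition positive_top :: "nat \<Rightarrow> int list set" where
  "positive_top n = {L \<in> signed_perms n. int n \<in> set L}"

lemma length_signed_perms:
  assumes "L \<in> signed_perms n"
  shows "length L = n"
proof -
  have "length L = card (abs ` set L)"
    using assms distinct_card[of "map abs L"] by (simp add: signed_perms_def)
  then show ?thesis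
    using assms by (simp add: signed_perms_def)
qed

lemma finite_signed_perms: "finite (signed_perms n)"
proof (rule finite_subset)
  have "\<bar>x\<bar> \<in> {1..int n}" if "L \<in> signed_perms n" "x \<in> set L" for L x
    using that by (auto simp: signed_perms_def)
  then show "signed_perms n \<subseteq> {L. set L \<subseteq> {- int n..int n} \<and> length L = n}"
    using length_signed_perms by (force simp: abs_le_iff)
qed (simp add: finite_lists_length_eq)

lemma finite_positive_top: "finite (positive_top n)"
  using finite_signed_perms by (auto simp: positive_top_def)

lemma signed_perms_0: "signed_perms 0 = {[]}"
  by (auto simp: signed_perms_def)

lemma signed_perms_snoc:
  "L @ [int (Suc n)] \<in> signed_perms (Suc n) \<longleftrightarrow> L \<in> signed_perms n"
proof -
  have split: "{1..int (Suc n)} = insert (int (Suc n)) {1..int n}" "int (Suc n) \<notin> {1..int n}"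
    by auto
  have "L @ [int (Suc n)] \<in> signed_perms (Suc n) \<longleftrightarrow> distinct (map abs L) \<and>
      int (Suc n) \<notin> abs ` set L \<and> insert (int (Suc n)) (abs ` set L) = {1..int (Suc n)}"
    by (auto simp: signed_perms_def simp del: of_nat_Suc)
  also have "\<dots> \<longleftrightarrow> distinct (map abs L) \<and> abs ` set L = {1..int n}"
    using split by (metis insert_ident)
  finally show ?thesis
    by (simp add: signed_perms_def)
qed

text \<open>\<open>m\<close> may exceed \<open>n\<close> because the induction over dimensions uses
  one labelling of the large sphere on all its lower-dimensional equators.\<close>

lemma prefix_signed_sets:
  assumes "L \<in> signed_perms n" "i < n" "n \<le> m"
  shows "set (take (Suc i) L) \<in> signed_sets m"
proof -
  have len: "length L = n"
    using assms length_signed_perms by auto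
  have sub: "set (take (Suc i) L) \<subseteq> set L"
    by (rule set_take_subset)
  have abs: "\<bar>x\<bar> \<in> {1..int n}" if "x \<in> set L" for x
    using that assms by (auto simp: signed_perms_def)
  have inj: "inj_on abs (set L)"
    using assms by (simp add: signed_perms_def distinct_map)
  have "- x \<notin> set L" if "x \<in> set L" for x
    using inj_onD[OF inj, of x "- x"] that abs[OF that] by auto
  moreover have "set (take (Suc i) L) \<noteq> {}"
    using len assms by auto
  moreover have "set L \<subseteq> {- int m..int m}"
    using abs assms(3) by (fastforce simp: subset_iff)
  ultimately show ?thesis
    using sub by (auto simp: signed_sets_def)
qed

text \<open>The hypothesis of Tucker's lemma: an antipodal labelling by signed numbers without
  complementary edges, with absolute value \<open>index\<close> and sign
  \<open>side\<close>.\<close>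

locale octahedral_labelling =
  fixes n :: nat and index :: "int set \<Rightarrow> nat" and side :: "int set \<Rightarrow> bool"
  assumes index_uminus: "X \<in> signed_sets n \<Longrightarrow> index (uminus ` X) = index X"
    and side_uminus: "X \<in> signed_sets n \<Longrightarrow> side (uminus ` X) = (\<not> side X)"
    and no_complementary: "X \<in> signed_sets n \<Longrightarrow> Y \<in> signed_sets n \<Longrightarrow> X \<subseteq> Y \<Longrightarrow>
      index X = index Y \<Longrightarrow> side X = side Y"
begin

text \<open>Both signs of a label are packed into one natural number, so that sorting a list of labels
  orders them by absolute value and parity is the sign.\<close>

definition label :: "int set \<Rightarrow> nat" where
  "label X = 2 * index X + (if side X then 0 else 1)"

definition flip :: "nat \<Rightarrow> nat" where
  "flip x = (if even x then x + 1 else x - 1)"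

definition chain_label :: "int list \<Rightarrow> nat \<Rightarrow> nat" where
  "chain_label L i = label (set (take (Suc i) L))"

definition labels :: "int list \<Rightarrow> nat list" where
  "labels L = sort (map (chain_label L) [0..<length L])"

text \<open>The sorted labels of the chain without its \<open>i\<close>-th set; deleting any one
  copy of that label gives the same list.\<close>

definition facet :: "int list \<Rightarrow> nat \<Rightarrow> nat list" where
  "facet L i = remove1 (chain_label L i) (labels L)"

lemma label_div2: "label X div 2 = index X"
  by (simp add: label_def)

lemma sorted_labels: "sorted (labels L)"
  by (simp add: labels_def)

lemma length_labels [simp]: "length (labels L) = length L"
  by (simp add: labels_def)

lemma mset_facet:
  assumes "i < length L"
  shows "mset (facet L i) = image_mset (chain_label L) (mset_set ({..<length L} - {i}))"
proof -
  have "mset (labels L) = image_mset (chain_label L) (mset_set {..<length L})"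
    by (simp add: labels_def lessThan_atLeast0)
  moreover have "mset_set {..<length L} = add_mset i (mset_set ({..<length L} - {i}))"
    using assms by (simp add: mset_set.remove)
  ultimately show ?thesis
    by (simp add: facet_def)
qed

text \<open>The dropped set does not enter, so chains that differ only there share this facet.
  Sorted lists are compared through their multisets.\<close>

lemma facet_eqI:
  assumes "i < length L" "length L = length L'"
    and "\<And>j. j < length L \<Longrightarrow> j \<noteq> i \<Longrightarrow> set (take (Suc j) L) = set (take (Suc j) L')"
  shows "facet L i = facet L' i"
proof -
  have "image_mset (chain_label L) (mset_set ({..<length L} - {i})) =
        image_mset (chain_label L') (mset_set ({..<length L} - {i}))"
    by (rule image_mset_cong) (use assms(3) in \<open>auto simp: chain_label_def\<close>)
  then have "mset (facet L i) = mset (facet L' i)"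
    using assms(1,2) mset_facet[of i L] mset_facet[of i L'] by simp
  moreover have "sorted (facet L i)" "sorted (facet L' i)"
    by (simp_all add: facet_def sorted_labels sorted_remove1)
  ultimately show ?thesis
    by (metis properties_for_sort)
qed

lemma chain_labels_comparable:
  assumes L: "L \<in> signed_perms d" "d \<le> n" and ij: "i < d" "j < d"
    and eq: "chain_label L i div 2 = chain_label L j div 2"
  shows "chain_label L i = chain_label L j"
  using ij eq
proof (induction i j rule: linorder_wlog)
  case (le i j)
  have "set (take (Suc i) L) \<subseteq> set (take (Suc j) L)"
    using le by (intro set_take_subset_set_take) simp
  then have "side (set (take (Suc i) L)) = side (set (take (Suc j) L))"
    using le L by (intro no_complementary) (auto simp: prefix_signed_sets chain_label_def label_div2)
  then show ?case
    using le by (simp add: chain_label_def label_def)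
qed auto

lemma labels_complementary_free:
  assumes "L \<in> signed_perms d" "d \<le> n" "x \<in> set (labels L)" "y \<in> set (labels L)"
    "x div 2 = y div 2"
  shows "x = y"
  using assms chain_labels_comparable[OF assms(1,2)] length_signed_perms[OF assms(1)]
  by (auto simp: labels_def)

lemma label_uminus: "X \<in> signed_sets n \<Longrightarrow> label (uminus ` X) = flip (label X)"
  by (simp add: label_def index_uminus side_uminus flip_def)

lemma signed_perms_uminus: "map uminus L \<in> signed_perms d \<longleftrightarrow> L \<in> signed_perms d"
  by (simp add: signed_perms_def image_image comp_def)

lemma labels_uminus:
  assumes L: "L \<in> signed_perms d" "d \<le> n"
  shows "labels (map uminus L) = map flip (labels L)"
proof -
  have len: "length L = d"
    using L length_signed_perms by auto
  have "chain_label (map uminus L) i = flip (chain_label L i)" if "i < d" for i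
    using label_uminus[OF prefix_signed_sets[OF L(1) that L(2)]]
    by (simp add: chain_label_def take_map)
  then have "mset (map flip (labels L)) = mset (map (chain_label (map uminus L)) [0..<length L])"
    by (auto simp: labels_def len image_mset.compositionality intro!: image_mset_cong)
  \<comment> \<open>\<open>flip\<close> swaps \<open>2 * a\<close> and \<open>2 * a + 1\<close>, so
    it is not monotone in general; it is on the labels of one chain, which never contain
    both.\<close>
  moreover have "sorted (map flip (labels L))"
    unfolding sorted_map
  proof (rule sorted_wrt_mono_rel[OF _ sorted_labels])
    fix x y assume xy: "x \<in> set (labels L)" "y \<in> set (labels L)" "x \<le> y"
    show "flip x \<le> flip y"
    proof (cases "x = y")
      case False
      then have "x div 2 \<noteq> y div 2"
        using labels_complementary_free[OF L xy(1,2)] by auto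
      then show ?thesis
        using xy(3) by (auto simp: flip_def elim!: evenE oddE)
    qed simp
  qed
  ultimately show ?thesis
    unfolding labels_def[of "map uminus L"] by (intro properties_for_sort) simp_all
qed

lemma alternating_labels_uminus:
  assumes "L \<in> signed_perms d" "d \<le> n"
  shows "alternating even s (labels (map uminus L)) \<longleftrightarrow> alternating even (\<not> s) (labels L)"
proof -
  have "even (flip x) \<longleftrightarrow> odd x" for x
    by (auto simp: flip_def)
  then have "even \<circ> flip = odd"
    by (simp add: fun_eq_iff)
  then show ?thesis
    unfolding labels_uminus[OF assms] alternating_map by (simp add: alternating_neg)
qed

lemma odd_alternating_facets:
  assumes "L \<in> signed_perms d" "0 < d"
  shows "odd (card {i. i < d \<and> alternating even True (facet L i)}) \<longleftrightarrow>
         alternating even True (labels L) \<or> alternating even False (labels L)"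
proof -
  have len: "length L = d"
    using assms length_signed_perms by auto
  let ?Q = "\<lambda>x. alternating even True (remove1 x (labels L))"
  have "{i. i < d \<and> alternating even True (facet L i)} =
        {i. i < length (map (chain_label L) [0..<d]) \<and> ?Q (map (chain_label L) [0..<d] ! i)}"
    by (auto simp: facet_def)
  then have "card {i. i < d \<and> alternating even True (facet L i)} =
      length (filter ?Q (map (chain_label L) [0..<d]))"
    by (simp only: length_filter_conv_card)
  \<comment> \<open>Sorting permutes the entries, so positions in the chain and in the sorted list
    are equally many.\<close>
  also have "\<dots> = length (filter ?Q (labels L))"
    by (simp add: labels_def len filter_sort del: length_map filter_map)
  finally have *: "card {i. i < d \<and> alternating even True (facet L i)} =
      length (filter ?Q (labels L))" .
  have "labels L \<noteq> []"
    using assms(2) len length_labels[of L] by fastforce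
  from odd_alternating_removals[OF sorted_labels this, of even True] show ?thesis
    unfolding * by simp
qed

section \<open>Parity of the number of alternating simplices\<close>

definition fan_number :: "nat \<Rightarrow> nat" where
  "fan_number d = card {L \<in> signed_perms d. alternating even True (labels L)}"

lemma signed_perms_top_cases:
  assumes "L \<in> signed_perms d" "0 < d"
  shows "int d \<in> set L \<longleftrightarrow> - int d \<notin> set L"
proof -
  have "int d \<in> abs ` set L" "inj_on abs (set L)"
    using assms by (auto simp: signed_perms_def distinct_map)
  then show ?thesis
    using assms(2) by (auto simp: abs_if inj_on_def split: if_splits) force+
qed

text \<open>The antipodal map carries the alternating chains of the lower hemisphere that start
  positively to those of the upper one that start negatively.\<close>

lemma fan_number_conv_positive_top:
  assumes "0 < d" "d \<le> n"
  shows "fan_number d = card {L \<in> positive_top d.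
           alternating even True (labels L) \<or> alternating even False (labels L)}"
proof -
  let ?A = "\<lambda>s. {L \<in> positive_top d. alternating even s (labels L)}"
  let ?B = "{L \<in> signed_perms d. - int d \<in> set L \<and> alternating even True (labels L)}"
  have fin: "finite (?A s)" "finite ?B" for s
    using finite_signed_perms finite_positive_top by auto
  have "bij_betw (map uminus) (?A False) ?B"
  proof (rule bij_betwI[where g = "map uminus"])
    show "map uminus \<in> ?A False \<rightarrow> ?B"
      using assms by (auto simp: positive_top_def signed_perms_uminus alternating_labels_uminus)
    show "map uminus \<in> ?B \<rightarrow> ?A False"
      using assms by (auto simp: positive_top_def signed_perms_uminus alternating_labels_uminus
          image_iff) force
  qed (simp_all add: comp_def)
  then have "card ?B = card (?A False)"
    by (rule bij_betw_same_card[symmetric])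
  moreover have "{L \<in> signed_perms d. alternating even True (labels L)} = ?A True \<union> ?B"
    using signed_perms_top_cases assms(1) by (auto simp: positive_top_def)
  moreover have "?A True \<inter> ?B = {}"
    using signed_perms_top_cases assms(1) by (auto simp: positive_top_def)
  moreover have "?A True \<inter> ?A False = {}"
  proof -
    have "\<not> (alternating even True (labels L) \<and> alternating even False (labels L))"
      if "L \<in> signed_perms d" for L
      using length_signed_perms[OF that] length_labels[of L] assms(1) by (cases "labels L") auto
    then show ?thesis
      by (auto simp: positive_top_def)
  qed
  moreover have "{L \<in> positive_top d.
           alternating even True (labels L) \<or> alternating even False (labels L)} = ?A True \<union> ?A False"
    by auto
  ultimately show ?thesis
    using fin by (simp add: fan_number_def card_Un_disjoint)
qed

text \<open>Swapping entries \<open>i\<close> and \<open>i + 1\<close> changes only the dropped set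
  and keeps the set of all entries, so each inner facet lies in a second chain of the same
  hemisphere.\<close>

lemma even_inner_facets:
  "even (card {(L, i). L \<in> positive_top d \<and> Suc i < d \<and> alternating even True (facet L i)})"
    (is "even (card ?S)")
proof -
  define sw where "sw L i = L[i := L ! Suc i, Suc i := L ! i]" for L :: "int list" and i
  have main: "sw L i \<in> positive_top d \<and> facet (sw L i) i = facet L i \<and> sw (sw L i) i = L \<and>
      sw L i \<noteq> L" if L: "L \<in> positive_top d" and i: "Suc i < d" for L i
  proof (intro conjI)
    have perm: "L \<in> signed_perms d" and len: "length L = d"
      using L length_signed_perms by (auto simp: positive_top_def)
    have set: "set (sw L i) = set L"
      using i len by (simp add: sw_def)
    have map: "map abs (sw L i) = (map abs L)[i := map abs L ! Suc i, Suc i := map abs L ! i]"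
      using i len by (simp add: sw_def map_update)
    have "distinct (map abs (sw L i))"
      unfolding map using i len perm by (subst distinct_swap) (auto simp: signed_perms_def)
    then show "sw L i \<in> positive_top d"
      using L by (simp add: positive_top_def signed_perms_def set)
    show "sw (sw L i) i = L"
      using i len by (auto simp: sw_def nth_list_update intro!: nth_equalityI)
    have "distinct L"
      using perm by (auto simp: signed_perms_def distinct_map)
    then have "L ! Suc i \<noteq> L ! i"
      using i len by (simp add: nth_eq_iff_index_eq)
    moreover have "sw L i ! i = L ! Suc i"
      using i len by (simp add: sw_def)
    ultimately show "sw L i \<noteq> L"
      by auto
    \<comment> \<open>Only the prefix ending at position \<open>i\<close> separates the two swapped
      entries.\<close>
    have "set (take (Suc j) (sw L i)) = set (take (Suc j) L)" if "j < d" "j \<noteq> i" for j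
    proof (cases "j < i")
      case True
      then show ?thesis
        by (simp add: sw_def)
    next
      case False
      then have *: "Suc i < Suc j"
        using that by simp
      then have "take (Suc j) (sw L i) =
          (take (Suc j) L)[i := take (Suc j) L ! Suc i, Suc i := take (Suc j) L ! i]"
        unfolding sw_def take_update_swap by simp
      also have "set \<dots> = set (take (Suc j) L)"
        by (rule set_swap) (use * that len in auto)
      finally show ?thesis .
    qed
    then show "facet (sw L i) i = facet L i"
      using i len by (intro facet_eqI) (auto simp: sw_def)
  qed
  show ?thesis
    by (rule even_card_involution[where h = "\<lambda>(L, i). (sw L i, i)"]) (use main in auto)
qed

text \<open>Dropping the largest set forgets the last sign. When the last entry is not the positive
  top, the top stands earlier and survives the sign change, so the partner chain is in the
  hemisphere too.\<close>

lemma even_reflected_facets: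
  "even (card {L \<in> positive_top (Suc d). L ! d \<noteq> int (Suc d) \<and> alternating even True (facet L d)})"
proof -
  define fl where "fl L = L[d := - (L ! d)]" for L :: "int list"
  have main: "fl L \<in> positive_top (Suc d) \<and> facet (fl L) d = facet L d \<and> fl (fl L) = L \<and>
      fl L \<noteq> L \<and> fl L ! d \<noteq> int (Suc d)"
    if L: "L \<in> positive_top (Suc d)" and neq: "L ! d \<noteq> int (Suc d)" for L
  proof (intro conjI)
    have perm: "L \<in> signed_perms (Suc d)" and len: "length L = Suc d"
      and top: "int (Suc d) \<in> set L"
      using L length_signed_perms by (auto simp: positive_top_def)
    have map: "map abs (fl L) = map abs L"
      using len by (auto simp: fl_def map_update intro!: list_update_same_conv[THEN iffD2])
    then have "set (map abs (fl L)) = set (map abs L)"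
      by (rule arg_cong)
    then have abs: "abs ` set (fl L) = abs ` set L"
      by simp
    have "\<bar>L ! d\<bar> \<in> {1..int (Suc d)}"
      using perm len by (force simp: signed_perms_def)
    then have nz: "L ! d \<noteq> 0"
      by auto
    obtain j where j: "j < Suc d" "L ! j = int (Suc d)"
      using top len by (auto simp: in_set_conv_nth)
    then have "j \<noteq> d"
      using neq by auto
    then have "fl L ! j = int (Suc d)"
      using j by (simp add: fl_def)
    then have top': "int (Suc d) \<in> set (fl L)"
      using j(1) len by (metis fl_def length_list_update nth_mem)
    then show "fl L \<in> positive_top (Suc d)"
      using perm map abs by (simp add: positive_top_def signed_perms_def)
    show "fl (fl L) = L"
      using len by (simp add: fl_def)
    have d: "fl L ! d = - (L ! d)"
      using len by (simp add: fl_def)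
    then show "fl L \<noteq> L"
      using nz by auto
    show "fl L ! d \<noteq> int (Suc d)"
    proof
      assume "fl L ! d = int (Suc d)"
      then have "- int (Suc d) \<in> set L"
        using d len by (metis minus_minus nth_mem lessI)
      then show False
        using signed_perms_top_cases[OF perm] top by simp
    qed
    show "facet (fl L) d = facet L d"
      using len by (intro facet_eqI) (auto simp: fl_def)
  qed
  show ?thesis
    by (rule even_card_involution[where h = fl]) (use main in auto)
qed

text \<open>These are the boundary facets of the hemisphere: a chain that adds the top last becomes,
  without its largest set, a chain of the equator.\<close>

lemma card_equator_facets:
  "card {L \<in> positive_top (Suc d). L ! d = int (Suc d) \<and> alternating even True (facet L d)} =
   fan_number d"
proof -
  have facet: "facet (L @ [int (Suc d)]) d = labels L" if "L \<in> signed_perms d" for L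
  proof -
    have len: "length L = d"
      using that by (rule length_signed_perms)
    have "map (chain_label (L @ [int (Suc d)])) [0..<d] = map (chain_label L) [0..<d]"
      by (auto simp: chain_label_def len)
    then have "mset (facet (L @ [int (Suc d)]) d) = mset (labels L)"
      unfolding facet_def labels_def mset_remove1 mset_sort
      by (simp only: len length_append_singleton upt_Suc_append[OF le0] map_append mset_append
          list.map mset.simps add_mset_remove_trivial add_mset_add_single[symmetric])
    then show ?thesis
      by (metis facet_def properties_for_sort sorted_labels sorted_remove1)
  qed
  have "bij_betw (\<lambda>L. L @ [int (Suc d)])
      {L \<in> signed_perms d. alternating even True (labels L)}
      {L \<in> positive_top (Suc d). L ! d = int (Suc d) \<and> alternating even True (facet L d)}"
  proof (rule bij_betw_imageI)
    show "inj_on (\<lambda>L. L @ [int (Suc d)]) {L \<in> signed_perms d. alternating even True (labels L)}"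
      by (auto simp: inj_on_def)
    show "(\<lambda>L. L @ [int (Suc d)]) ` {L \<in> signed_perms d. alternating even True (labels L)} =
      {L \<in> positive_top (Suc d). L ! d = int (Suc d) \<and> alternating even True (facet L d)}"
      (is "?l = ?r")
    proof (intro equalityI subsetI)
      fix K assume "K \<in> ?l"
      then obtain L where L: "K = L @ [int (Suc d)]" "L \<in> signed_perms d"
        "alternating even True (labels L)"
        by auto
      have "K ! d = int (Suc d)"
        using length_signed_perms[OF L(2)] by (simp add: L(1) nth_append)
      then show "K \<in> ?r"
        using L facet signed_perms_snoc by (auto simp: positive_top_def)
    next
      fix K assume K: "K \<in> ?r"
      then have len: "length K = Suc d"
        using length_signed_perms by (auto simp: positive_top_def)
      then have "K \<noteq> []"
        by auto
      then have "butlast K @ [K ! d] = K"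
        using len append_butlast_last_id[of K] last_conv_nth[of K] by simp
      moreover have "K ! d = int (Suc d)"
        using K by blast
      ultimately have "K = butlast K @ [int (Suc d)]"
        by (simp only:)
      then obtain L where L: "K = L @ [int (Suc d)]"
        by blast
      then show "K \<in> ?l"
        using K facet signed_perms_snoc by (auto simp: positive_top_def)
    qed
  qed
  then show ?thesis
    unfolding fan_number_def by (rule bij_betw_same_card[symmetric])
qed

text \<open>Double counting of pairs of a hemisphere chain and an alternating facet. Facets inside
  the hemisphere come in twos, so modulo 2 only the equator counts, which is the lower
  dimension.\<close>

lemma odd_fan_number: "d \<le> n \<Longrightarrow> odd (fan_number d)"
proof (induction d)
  case 0
  have "{L \<in> signed_perms 0. alternating even True (labels L)} = {[]}"
    by (auto simp: signed_perms_0 labels_def)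
  then show ?case
    by (simp add: fan_number_def)
next
  case (Suc d)
  let ?U = "positive_top (Suc d)"
  let ?g = "\<lambda>L i. alternating even True (facet L i)"
  let ?S1 = "{(L, i). L \<in> ?U \<and> Suc i < Suc d \<and> ?g L i}"
  let ?S2 = "{L \<in> ?U. L ! d \<noteq> int (Suc d) \<and> ?g L d}"
  let ?S3 = "{L \<in> ?U. L ! d = int (Suc d) \<and> ?g L d}"
  have fin: "finite ?U"
    by (rule finite_positive_top)
  have fin': "finite ?S1" "finite ?S2" "finite ?S3"
    using fin by (auto intro: finite_subset[of _ "?U \<times> {..<Suc d}"])
  have sigma: "(SIGMA L:?U. {i. i < Suc d \<and> ?g L i}) = ?S1 \<union> (?S2 \<times> {d} \<union> ?S3 \<times> {d})"
    by (auto simp: less_Suc_eq)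
  have union: "card (?S1 \<union> (?S2 \<times> {d} \<union> ?S3 \<times> {d})) = card ?S1 + (card ?S2 + card ?S3)"
    by (subst card_Un_disjoint, use fin' in simp, use fin' in simp, force)
      (subst card_Un_disjoint, use fin' in \<open>auto simp: card_cartesian_product_singleton card_cartesian_product\<close>)
  have "card (SIGMA L:?U. {i. i < Suc d \<and> ?g L i}) = (\<Sum>L\<in>?U. card {i. i < Suc d \<and> ?g L i})"
    using fin by simp
  then have sum: "(\<Sum>L\<in>?U. card {i. i < Suc d \<and> ?g L i}) =
      card ?S1 + (card ?S2 + card ?S3)"
    unfolding sigma union by (rule sym)
  have "even (card ?S1)" "even (card ?S2)"
    by (rule even_inner_facets, rule even_reflected_facets)
  moreover have "odd (card ?S3)"
    using Suc unfolding card_equator_facets by simp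
  ultimately have "odd (\<Sum>L\<in>?U. card {i. i < Suc d \<and> ?g L i})"
    unfolding sum by (simp only: even_add) simp
  \<comment> \<open>Summed over chains instead, a term is odd exactly for the chains that alternate
    themselves.\<close>
  then have "odd (card {L \<in> ?U. odd (card {i. i < Suc d \<and> ?g L i})})"
    using even_sum_iff[OF fin] by blast
  also have "{L \<in> ?U. odd (card {i. i < Suc d \<and> ?g L i})} =
      {L \<in> ?U. alternating even True (labels L) \<or> alternating even False (labels L)}"
    using odd_alternating_facets[of _ "Suc d"] by (auto simp: positive_top_def)
  also have "card \<dots> = fan_number (Suc d)"
    using fan_number_conv_positive_top Suc.prems by simp
  finally show ?case .
qed

text \<open>An alternating chain exists because their number is odd, and its \<open>n\<close> labels
  have distinct indices below \<open>m\<close>.\<close>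

theorem octahedral_tucker:
  assumes "\<And>X. X \<in> signed_sets n \<Longrightarrow> index X < m"
  shows "n \<le> m"
proof -
  have "fan_number n \<noteq> 0"
    using odd_fan_number[of n] by (intro notI) simp
  then have "{L \<in> signed_perms n. alternating even True (labels L)} \<noteq> {}"
    unfolding fan_number_def by (rule contrapos_nn) (simp only: card.empty)
  then obtain L where L: "L \<in> signed_perms n" "alternating even True (labels L)"
    by (auto simp only: ex_in_conv[symmetric] mem_Collect_eq)
  have len: "length L = n" "length (labels L) = n"
    using length_signed_perms[OF L(1)] by (auto simp: labels_def)
  let ?xs = "map (\<lambda>x. x div 2) (labels L)"
  \<comment> \<open>Neighbouring labels differ in parity, hence differ, and not being complementary
    they differ in index as well.\<close>
  have "labels L ! i div 2 < labels L ! j div 2" if "i < j" "j < n" for i j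
    using that
  proof (induction j)
    case (Suc j)
    have "labels L ! j \<le> labels L ! Suc j"
      using Suc.prems len sorted_labels by (simp add: sorted_iff_nth_mono)
    moreover have "labels L ! j \<noteq> labels L ! Suc j"
      using L(2) Suc.prems len unfolding alternating_nth by (metis Suc_lessD even_Suc)
    moreover have "labels L ! j div 2 \<noteq> labels L ! Suc j div 2"
      using labels_complementary_free[OF L(1) order_refl] Suc.prems len calculation(2)
      by (metis Suc_lessD nth_mem)
    ultimately have "labels L ! j div 2 < labels L ! Suc j div 2"
      by (meson div_le_mono le_neq_implies_less)
    then show ?case
      using Suc by (cases "i = j") auto
  qed simp
  then have "distinct ?xs"
    by (auto simp: distinct_conv_nth len) (metis linorder_neqE_nat nat_neq_iff)
  moreover have "set ?xs \<subseteq> {..<m}"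
    using assms prefix_signed_sets[OF L(1) _ order_refl]
    by (auto simp: labels_def len chain_label_def label_div2)
  ultimately have "card {..<m} \<ge> n"
    using distinct_card[of ?xs] card_mono[of "{..<m}" "set ?xs"] len by simp
  then show ?thesis
    by simp
qed

end

subsection \<open>Lower bound for the chromatic number\<close>

text \<open>Alternating subsequences of a sign vector, with coordinates in increasing order;
  \<open>s\<close> is true for a positive start.\<close>

definition alternating_in :: "bool \<Rightarrow> int set \<Rightarrow> int list \<Rightarrow> bool" where
  "alternating_in s X xs \<longleftrightarrow>
     set xs \<subseteq> X \<and> sorted_wrt (<) (map abs xs) \<and> alternating (\<lambda>x. 0 < x) s xs"

definition alt_from :: "bool \<Rightarrow> int set \<Rightarrow> nat" where
  "alt_from s X = Max (length ` {xs. alternating_in s X xs})"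

lemma alternating_in_mono: "alternating_in s X xs \<Longrightarrow> X \<subseteq> Y \<Longrightarrow> alternating_in s Y xs"
  by (auto simp: alternating_in_def)

lemma length_alternating_in:
  assumes "finite X" "alternating_in s X xs"
  shows "length xs \<le> card X"
proof -
  have "distinct (map abs xs)"
    using assms(2) strict_sorted_iff[of "map abs xs"] by (simp add: alternating_in_def)
  then have "length xs = card (set xs)"
    by (simp add: distinct_map distinct_card)
  then show ?thesis
    using assms card_mono[of X "set xs"] by (simp add: alternating_in_def)
qed

lemma finite_alternating_lengths: "finite X \<Longrightarrow> finite (length ` {xs. alternating_in s X xs})"
  by (rule finite_subset[of _ "{..card X}"]) (use length_alternating_in in auto)

lemma alt_from_ge: "finite X \<Longrightarrow> alternating_in s X xs \<Longrightarrow> length xs \<le> alt_from s X"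
  unfolding alt_from_def by (rule Max_ge[OF finite_alternating_lengths]) auto

lemma alt_from_attained:
  assumes "finite X"
  obtains xs where "alternating_in s X xs" "length xs = alt_from s X"
proof -
  have "[] \<in> {xs. alternating_in s X xs}"
    by (simp add: alternating_in_def)
  then have "length ` {xs. alternating_in s X xs} \<noteq> {}"
    by blast
  from Max_in[OF finite_alternating_lengths[OF assms] this] show ?thesis
    using that unfolding alt_from_def by auto
qed

lemma alt_from_mono:
  assumes "X \<subseteq> Y" "finite Y"
  shows "alt_from s X \<le> alt_from s Y"
proof -
  obtain xs where "alternating_in s X xs" "length xs = alt_from s X"
    using alt_from_attained assms finite_subset by metis
  then show ?thesis
    using alt_from_ge[OF assms(2), of s xs] alternating_in_mono[OF _ assms(1)] by simp
qed

lemma alternating_in_uminus: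
  assumes "alternating_in s X xs" "0 \<notin> X"
  shows "alternating_in (\<not> s) (uminus ` X) (map uminus xs)"
proof -
  have "alternating ((\<lambda>x. 0 < x) \<circ> uminus) (\<not> s) xs \<longleftrightarrow> alternating (\<lambda>x. \<not> 0 < x) (\<not> s) xs"
  proof (rule alternating_cong)
    fix x assume "x \<in> set xs"
    then have "x \<noteq> 0"
      using assms by (auto simp: alternating_in_def)
    then show "((\<lambda>x. 0 < x) \<circ> uminus) x \<longleftrightarrow> \<not> 0 < x"
      by auto
  qed
  then show ?thesis
    using assms by (auto simp: alternating_in_def alternating_map alternating_neg comp_def)
qed

lemma alt_from_uminus:
  assumes "finite X" "0 \<notin> X"
  shows "alt_from s (uminus ` X) = alt_from (\<not> s) X"
proof -
  have le: "alt_from t X \<le> alt_from (\<not> t) (uminus ` X)" if "finite X" "0 \<notin> X" for t X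
  proof -
    obtain xs where "alternating_in t X xs" "length xs = alt_from t X"
      using alt_from_attained[OF \<open>finite X\<close>] .
    then show ?thesis
      using alt_from_ge[of "uminus ` X", OF _ alternating_in_uminus] that by fastforce
  qed
  have "0 \<notin> uminus ` X"
    using assms by force
  then show ?thesis
    using le[of X "\<not> s"] le[of "uminus ` X" s] assms
    by (intro antisym) (simp_all add: image_image)
qed

lemma signed_setsD:
  assumes "X \<in> signed_sets n"
  shows "finite X" "0 \<notin> X" "X \<noteq> {}" "x \<in> X \<Longrightarrow> - x \<notin> X" "x \<in> X \<Longrightarrow> \<bar>x\<bar> \<in> {1..int n}"
proof -
  show fin: "finite X" and "X \<noteq> {}"
    using assms by (auto simp: signed_sets_def intro: finite_subset)
  show zero: "0 \<notin> X"
    using assms by (force simp: signed_sets_def)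
  show "x \<in> X \<Longrightarrow> - x \<notin> X"
    using assms by (force simp: signed_sets_def)
  show "\<bar>x\<bar> \<in> {1..int n}" if "x \<in> X"
  proof -
    have "x \<noteq> 0"
      using zero that by auto
    moreover have "x \<in> {- int n..int n}"
      using assms that by (auto simp: signed_sets_def)
    ultimately show ?thesis
      by auto
  qed
qed

lemma signed_sets_uminus: "X \<in> signed_sets n \<Longrightarrow> uminus ` X \<in> signed_sets n"
  by (fastforce simp: signed_sets_def image_image)

text \<open>Of two nonempty alternating lists starting with opposite signs, the one whose first
  element is larger can be extended by the first element of the other.\<close>

lemma alt_from_neq:
  assumes X: "X \<in> signed_sets n"
  shows "alt_from s X \<noteq> alt_from (\<not> s) X"
proof
  assume eq: "alt_from s X = alt_from (\<not> s) X"
  note fin = signed_setsD(1)[OF X]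
  obtain xs where xs: "alternating_in s X xs" "length xs = alt_from s X"
    using alt_from_attained[OF fin] .
  obtain ys where ys: "alternating_in (\<not> s) X ys" "length ys = alt_from s X"
    using alt_from_attained[OF fin, of "\<not> s"] eq by metis
  obtain a where a: "a \<in> X"
    using signed_setsD(3)[OF X] by auto
  then have "alternating_in (0 < a) X [a]"
    by (simp add: alternating_in_def)
  then have "1 \<le> alt_from (0 < a) X"
    using alt_from_ge[OF fin] by fastforce
  then have "0 < alt_from s X"
    using eq by (cases "s = (0 < a)") auto
  then obtain x xs' y ys' where Cons: "xs = x # xs'" "ys = y # ys'"
    using xs(2) ys(2) by (metis length_greater_0_conv neq_Nil_conv)
  have mem: "x \<in> X" "y \<in> X" and sign: "(0 < x) = s" "(0 < y) = (\<not> s)"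
    using xs ys by (auto simp: Cons alternating_in_def)
  have "\<bar>x\<bar> \<noteq> \<bar>y\<bar>"
    using signed_setsD(4)[OF X] mem sign by (auto simp: abs_eq_iff)
  then consider "\<bar>x\<bar> < \<bar>y\<bar>" | "\<bar>y\<bar> < \<bar>x\<bar>"
    by linarith
  then show False
  proof cases
    case 1
    then have "alternating_in s X (x # ys)"
      using xs ys sign mem by (force simp: Cons alternating_in_def)
    from alt_from_ge[OF fin this] ys(2) show False
      by simp
  next
    case 2
    then have "alternating_in (\<not> s) X (y # xs)"
      using xs ys sign mem by (force simp: Cons alternating_in_def)
    from alt_from_ge[OF fin this] xs(2) eq show False
      by simp
  qed
qed

definition alt :: "int set \<Rightarrow> nat" where
  "alt X = max (alt_from True X) (alt_from False X)"

lemma alt_uminus: "X \<in> signed_sets n \<Longrightarrow> alt (uminus ` X) = alt X"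
  by (simp add: alt_def alt_from_uminus signed_setsD max.commute)

lemma alt_pos: "X \<in> signed_sets n \<Longrightarrow> 0 < alt X"
  using alt_from_neq[of X n True] by (auto simp: alt_def)

text \<open>A skipped value lies between any two chosen ones. Both 1 and \<open>n\<close> could be
  chosen only at the indices 0 and \<open>2 * k - 1\<close>, whose parities differ.\<close>

lemma every_other_in_schrijver_vertices:
  assumes mono: "\<And>i j. i < j \<Longrightarrow> j < 2 * k \<Longrightarrow> f i < f j"
    and range: "\<And>i. i < 2 * k \<Longrightarrow> f i \<in> {1..n}" and "b < 2"
  shows "(\<lambda>i. f (2 * i + b)) ` {..<k} \<in> schrijver_vertices n k"
proof -
  let ?S = "(\<lambda>i. f (2 * i + b)) ` {..<k}"
  have idx: "2 * i + b < 2 * k" if "i < k" for i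
    using that assms(3) by linarith
  have less: "f (2 * i + b) + 2 \<le> f (2 * j + b)" if "i < j" "j < k" for i j
    using mono[of "2 * i + b" "2 * i + b + 1"] mono[of "2 * i + b + 1" "2 * j + b"]
      idx[of i] idx[of j] that by simp
  have "inj_on (\<lambda>i. f (2 * i + b)) {..<k}"
    by (rule linorder_inj_onI') (use less in fastforce)
  then have "card ?S = k"
    by (simp add: card_image)
  moreover have "\<not> {x, x + 1} \<subseteq> ?S" for x
  proof
    assume "{x, x + 1} \<subseteq> ?S"
    then obtain i j where "i < k" "j < k" "x = f (2 * i + b)" "x + 1 = f (2 * j + b)"
      by auto
    then show False
      using less[of i j] less[of j i] by (cases i j rule: linorder_cases) auto
  qed
  moreover have "\<not> {1, n} \<subseteq> ?S"
  proof
    assume "{1, n} \<subseteq> ?S"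
    then obtain i j where ij: "i < k" "j < k" "1 = f (2 * i + b)" "n = f (2 * j + b)"
      by auto
    have "2 * i + b = 0"
      using mono[of 0 "2 * i + b"] range[of 0] ij idx[of i] by force
    moreover have "2 * j + b = 2 * k - 1"
      using mono[of "2 * j + b" "2 * k - 1"] range[of "2 * k - 1"] ij idx[of j] by force
    ultimately show False
      using ij by presburger
  qed
  moreover have "?S \<subseteq> {1..n}"
    using range idx by blast
  ultimately show ?thesis
    by (simp add: schrijver_vertices_def)
qed

section \<open>Vertices inside signed sets and the lower bound\<close>

definition positive_part :: "int set \<Rightarrow> nat set" where
  "positive_part X = {i. int i \<in> X}"

lemma positive_part_mono: "X \<subseteq> Y \<Longrightarrow> positive_part X \<subseteq> positive_part Y"
  by (auto simp: positive_part_def)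

lemma disjoint_parts:
  "X \<in> signed_sets n \<Longrightarrow> positive_part X \<inter> positive_part (uminus ` X) = {}"
  using signed_setsD(4) by (auto simp: positive_part_def)

text \<open>The positive entries of an alternating list are every second one. Applied to the negated
  set, this also gives a vertex in the negative part.\<close>

lemma schrijver_vertex_in_positive_part:
  assumes X: "X \<in> signed_sets n" and "2 * k \<le> alt X"
  shows "\<exists>T \<in> schrijver_vertices n k. T \<subseteq> positive_part X"
proof -
  obtain s where "2 * k \<le> alt_from s X"
    using assms(2) by (auto simp: alt_def max_def split: if_splits)
  then obtain xs where xs: "alternating_in s X xs" "2 * k \<le> length xs"
    using alt_from_attained[OF signed_setsD(1)[OF X], of s] by metis
  define f where "f i = nat \<bar>xs ! i\<bar>" for i
  define b :: nat where "b = (if s then 0 else 1)"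
  have mem: "xs ! i \<in> X" if "i < 2 * k" for i
    using xs that by (auto simp: alternating_in_def)
  have sorted: "\<bar>xs ! i\<bar> < \<bar>xs ! j\<bar>" if "i < j" "j < 2 * k" for i j
    using xs that by (auto simp: alternating_in_def sorted_wrt_iff_nth_less)
  have "(\<lambda>i. f (2 * i + b)) ` {..<k} \<in> schrijver_vertices n k"
  proof (rule every_other_in_schrijver_vertices)
    show "f i < f j" if "i < j" "j < 2 * k" for i j
      using sorted[OF that] by (simp add: f_def)
    show "f i \<in> {1..n}" if "i < 2 * k" for i
      using signed_setsD(5)[OF X mem[OF that]] by (auto simp: f_def)
  qed (simp add: b_def)
  moreover have "(\<lambda>i. f (2 * i + b)) ` {..<k} \<subseteq> positive_part X"
  proof safe
    fix i assume "i < k"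
    then have i: "2 * i + b < 2 * k"
      by (auto simp: b_def)
    then have "0 < xs ! (2 * i + b)"
      using xs unfolding alternating_in_def alternating_nth by (auto simp: b_def)
    then show "f (2 * i + b) \<in> positive_part X"
      using mem[OF i] by (simp add: f_def positive_part_def)
  qed
  ultimately show ?thesis
    by blast
qed

text \<open>Tucker's lemma with \<open>2 * k - 1\<close> indices from alternation lengths and
  \<open>C - 1\<close> from colors.\<close>

theorem schrijver_lower_bound:
  assumes "k > 0" "C > 0" and c: "proper_coloring (schrijver_graph n k) C c"
  shows "n + 2 \<le> 2 * k + C"
proof -
  let ?V = "schrijver_vertices n k"
  have range: "c T \<in> {1..C}" if "T \<in> ?V" for T
    using c that by (simp add: proper_coloring_def schrijver_graph_def)
  have neq: "c S \<noteq> c T" if "S \<in> ?V" "T \<in> ?V" "S \<inter> T = {}" for S T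
    using c that by (auto simp: proper_coloring_def schrijver_graph_def)
  define cols where "cols X = c ` {T \<in> ?V. T \<subseteq> positive_part X}" for X
  define maxcol where "maxcol X = Max (cols X \<union> cols (uminus ` X))" for X
  \<comment> \<open>Lengths start at 1 and largest colors at 2; the offsets make the two ranges
    disjoint and fill the numbers below \<open>2 * k + C - 2\<close>.\<close>
  define index where
    "index X = (if alt X < 2 * k then alt X - 1 else 2 * k - 1 + (maxcol X - 2))" for X
  define side where
    "side X = (if alt X < 2 * k then alt_from False X < alt_from True X else maxcol X \<in> cols X)"
    for X
  have cols_mono: "cols X \<subseteq> cols Y" if "X \<subseteq> Y" for X Y
    using positive_part_mono[OF that] by (auto simp: cols_def)
  have cols_range: "cols X \<subseteq> {1..C}" for X
    using range by (auto simp: cols_def)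
  then have cols_finite: "finite (cols X)" for X
    by (rule finite_subset) simp
  have cols_disjoint: "cols X \<inter> cols (uminus ` X) = {}" if "X \<in> signed_sets n" for X
  proof -
    have "c S \<noteq> c T" if "S \<in> ?V" "S \<subseteq> positive_part X" "T \<in> ?V" "T \<subseteq> positive_part (uminus ` X)"
      for S T
      using neq[of S T] that disjoint_parts[OF \<open>X \<in> signed_sets n\<close>] by blast
    then show ?thesis
      by (auto simp: cols_def)
  qed
  have cols_nonempty: "cols X \<noteq> {}" if "X \<in> signed_sets n" "2 * k \<le> alt X" for X
    using schrijver_vertex_in_positive_part[OF that] by (auto simp: cols_def)
  have maxcol_in: "maxcol X \<in> cols X \<union> cols (uminus ` X)"
    if "X \<in> signed_sets n" "2 * k \<le> alt X" for X
    unfolding maxcol_def using cols_nonempty[OF that] cols_finite by (intro Max_in) auto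
  \<comment> \<open>Vertices in the two parts are disjoint, so at least two colors occur.\<close>
  have maxcol_bounds: "2 \<le> maxcol X" "maxcol X \<le> C"
    if X: "X \<in> signed_sets n" "2 * k \<le> alt X" for X
  proof -
    obtain a where a: "a \<in> cols X"
      using cols_nonempty[OF X] by auto
    obtain b where b: "b \<in> cols (uminus ` X)"
      using cols_nonempty[of "uminus ` X"] X alt_uminus[OF X(1)] signed_sets_uminus[OF X(1)] by auto
    have "a \<noteq> b" "1 \<le> a" "1 \<le> b"
      using a b cols_disjoint[OF X(1)] cols_range by force+
    moreover have "a \<le> maxcol X" "b \<le> maxcol X"
      using a b cols_finite by (simp_all add: maxcol_def)
    ultimately show "2 \<le> maxcol X"
      by linarith
    show "maxcol X \<le> C"
      using maxcol_in[OF X] cols_range by fastforce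
  qed
  have maxcol_uminus: "maxcol (uminus ` X) = maxcol X" for X
    by (simp add: maxcol_def image_image Un_commute)
  interpret octahedral_labelling n index side
  proof
    fix X assume X: "X \<in> signed_sets n"
    show "index (uminus ` X) = index X"
      by (simp add: index_def maxcol_uminus alt_uminus[OF X])
    show "side (uminus ` X) = (\<not> side X)"
    proof (cases "alt X < 2 * k")
      case True
      then show ?thesis
        using alt_from_neq[OF X, of True] X
        by (auto simp: side_def alt_uminus[OF X] alt_from_uminus signed_setsD)
    next
      case False
      then show ?thesis
        using maxcol_in[OF X] cols_disjoint[OF X]
        by (auto simp: side_def alt_uminus[OF X] maxcol_uminus)
    qed
  next
    fix X Y assume X: "X \<in> signed_sets n" and Y: "Y \<in> signed_sets n" and sub: "X \<subseteq> Y"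
      and eq: "index X = index Y"
    have "alt X < 2 * k \<longleftrightarrow> alt Y < 2 * k"
      using eq alt_pos[OF X] alt_pos[OF Y] by (auto simp: index_def split: if_splits)
    then consider "alt X < 2 * k" "alt Y < 2 * k" | "2 * k \<le> alt X" "2 * k \<le> alt Y"
      by linarith
    then show "side X = side Y"
    proof cases
      case 1
      then have "alt X = alt Y"
        using eq alt_pos[OF X] alt_pos[OF Y] by (simp add: index_def)
      \<comment> \<open>Both lengths can only grow from \<open>X\<close> to \<open>Y\<close> while
        their maximum stays, and ties are impossible, so the same starting sign wins.\<close>
      moreover have "alt_from s X \<le> alt_from s Y" for s
        using alt_from_mono[OF sub signed_setsD(1)[OF Y]] .
      ultimately show ?thesis
        using 1 alt_from_neq[OF X, of True] alt_from_neq[OF Y, of True]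
        by (simp add: side_def alt_def max_def split: if_splits)
          (metis le_antisym linorder_not_le order.strict_trans1)+
    next
      case 2
      have "maxcol X = maxcol Y"
        using eq 2 maxcol_bounds[OF X] maxcol_bounds[OF Y] by (simp add: index_def)
      \<comment> \<open>The part of \<open>X\<close> with the largest color passes it to the same
        part of \<open>Y\<close>, and the other part of \<open>Y\<close> cannot use it.\<close>
      moreover have "cols X \<subseteq> cols Y" "cols (uminus ` X) \<subseteq> cols (uminus ` Y)"
        using cols_mono sub by (simp_all add: image_mono)
      ultimately show ?thesis
        using 2 maxcol_in[OF X] cols_disjoint[OF Y] by (auto simp: side_def)
    qed
  qed
  have "index X < 2 * k + C - 2" if X: "X \<in> signed_sets n" for X
  proof (cases "alt X < 2 * k")
    case True
    then show ?thesis
      using alt_pos[OF X] assms(1,2) by (simp add: index_def)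
  next
    case False
    then show ?thesis
      using maxcol_bounds[OF X] assms(1) by (simp add: index_def)
  qed
  then have "n \<le> 2 * k + C - 2"
    by (rule octahedral_tucker)
  then show ?thesis
    using assms(1) by simp
qed

subsection \<open>Circular colorings\<close>

lemma mod_add_left_inj:
  fixes a p s t :: nat
  assumes "s < p" "t < p" "(a + s) mod p = (a + t) mod p"
  shows "s = t"
  using assms
proof (induction s t rule: linorder_wlog)
  case (le s t)
  then have "p dvd (a + t) - (a + s)"
    by (metis add_le_cancel_left mod_eq_dvd_iff_nat)
  then have "p dvd t - s"
    by simp
  then have "t - s = 0"
    using le by (meson less_imp_diff_less nat_dvd_not_less neq0_conv)
  then show ?case
    using le by simp
qed auto

text \<open>Cut the circle of colors, after a rotation, into \<^term>\<open>m\<close> arcs of length \<^term>\<open>q\<close> and a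
  rest. A rotation for which no vertex lands in the rest exists by counting.\<close>

lemma proper_coloring_of_pq_coloring:
  assumes fin: "finite (pverts G)"
    and c: "pq_coloring G p q c" and pq: "p > 0" "q > 0"
    and count: "card (pverts G) * (p - m * q) < p"
  shows "\<exists>c'. proper_coloring G m c'"
proof -
  let ?V = "pverts G"
  define bad where "bad v = {s \<in> {..<p}. m * q \<le> (c v + s) mod p}" for v
  have "card (bad v) \<le> p - m * q" for v
  proof -
    have "inj_on (\<lambda>s. (c v + s) mod p) (bad v)"
    proof (rule inj_onI)
      fix s s' assume s: "s \<in> bad v" "s' \<in> bad v" "(c v + s) mod p = (c v + s') mod p"
      then show "s = s'"
        by (intro mod_add_left_inj[OF _ _ s(3)]) (simp_all add: bad_def)
    qed
    moreover have "(\<lambda>s. (c v + s) mod p) ` bad v \<subseteq> {m * q..<p}"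
      using pq by (auto simp: bad_def)
    ultimately have "card (bad v) \<le> card {m * q..<p}"
      by (intro card_inj_on_le) auto
    then show ?thesis
      by simp
  qed
  then have "card (\<Union>v\<in>?V. bad v) \<le> card ?V * (p - m * q)"
    using card_UN_le[OF fin, of bad] sum_bounded_above[of ?V "\<lambda>v. card (bad v)" "p - m * q"]
    by fastforce
  then have "card (\<Union>v\<in>?V. bad v) < card {..<p}"
    using count by simp
  then have "\<not> {..<p} \<subseteq> (\<Union>v\<in>?V. bad v)"
    using card_mono[of "\<Union>v\<in>?V. bad v" "{..<p}"] fin by (auto simp: bad_def)
  then obtain s where "s < p" "\<forall>v\<in>?V. s \<notin> bad v"
    by auto
  then have s: "(c v + s) mod p < m * q" if "v \<in> ?V" for v
    using that by (simp add: bad_def not_le)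
  define r where "r v = (c v + s) mod p" for v
  define c' where "c' v = r v div q + 1" for v
  have "c' v \<in> {1..m}" if "v \<in> ?V" for v
    using s[OF that] by (simp add: c'_def r_def less_mult_imp_div_less Suc_leI)
  moreover have "c' u \<noteq> c' v" if uv: "(u, v) \<in> parcs G" for u v
  proof
    assume "c' u = c' v"
    then have "\<bar>int (r u) - int (r v)\<bar> < int q"
    proof -
      define z where "z = q * (r v div q)"
      have "r u div q = r v div q"
        using \<open>c' u = c' v\<close> by (simp add: c'_def)
      then have "r u = z + r u mod q" "r v = z + r v mod q"
        unfolding z_def by (metis mult_div_mod_eq)+
      moreover have "r u mod q < q" "r v mod q < q"
        using pq by simp_all
      ultimately show ?thesis
        by linarith
    qed
    \<comment> \<open>Rotation changes a difference of colors by a multiple of \<open>p\<close>. For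
      \<open>j = 0\<close> the original difference is below \<open>q\<close>, otherwise it exceeds
      \<open>p - q\<close>.\<close>
    moreover obtain j where j: "int (c u) - int (c v) = int (r u) - int (r v) + int p * j"
    proof
      have "int (c w) + int s = int p * int ((c w + s) div p) + int (r w)" for w
        unfolding r_def by (metis mult_div_mod_eq of_nat_add of_nat_mult)
      then show "int (c u) - int (c v) =
          int (r u) - int (r v) + int p * (int ((c u + s) div p) - int ((c v + s) div p))"
        by (smt (verit) right_diff_distrib)
    qed
    moreover have "int q \<le> \<bar>int (c u) - int (c v)\<bar>" "\<bar>int (c u) - int (c v)\<bar> \<le> int p - int q"
      using c uv by (auto simp: pq_coloring_def)
    moreover have "int p \<le> \<bar>int p * j\<bar>" if "j \<noteq> 0"
      using that pq by (simp add: abs_mult)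
    ultimately show False
      by (cases "j = 0") auto
  qed
  ultimately show ?thesis
    unfolding proper_coloring_def by blast
qed

text \<open>With \<open>N\<close> vertices, a ratio below \<open>m + 1 / N\<close> would leave so
  short a rest of the circle that cutting gives a proper coloring with \<open>m\<close> colors. This
  gap is uniform, so the infimum inherits strictness; the given coloring makes its set
  nonempty.\<close>

lemma circular_chromatic_number_gt:
  assumes fin: "finite (pverts G)" and ne: "pverts G \<noteq> {}" and m: "0 < m" "\<And>c. \<not> proper_coloring G m c"
    and col: "p > 0" "q > 0" "pq_coloring G p q c"
  shows "real m < circular_chromatic_number G"
proof -
  let ?N = "card (pverts G)"
  have N: "0 < ?N"
    using fin ne by (simp add: card_gt_0_iff)
  have "real m + 1 / real ?N \<le> x"
    if mem: "x \<in> {real p / real q | p q. p > 0 \<and> q > 0 \<and> (\<exists>c. pq_coloring G p q c)}" for x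
  proof (rule ccontr)
    assume x: "\<not> real m + 1 / real ?N \<le> x"
    obtain p q c where pq: "x = real p / real q" "p > 0" "q > 0" "pq_coloring G p q c"
      using mem by blast
    have "real p < real m * real q + real q / real ?N"
      using x pq N by (simp add: field_simps)
    then have *: "real ?N * (real p - real m * real q) < real q"
      using N by (simp add: field_simps)
    have "?N * (p - m * q) < p"
    proof (cases "p \<le> m * q")
      case False
      have "real (?N * (p - m * q)) = real ?N * (real p - real m * real q)"
        using False by (simp add: of_nat_diff)
      then have "?N * (p - m * q) < q"
        using * by linarith
      also have "q \<le> m * q"
        using m(1) by simp
      finally show ?thesis
        using False by simp
    qed (use pq in simp)
    then show False
      using proper_coloring_of_pq_coloring[OF fin pq(4,2,3)] m(2) by blast
  qed
  then have "real m + 1 / real ?N \<le> circular_chromatic_number G"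
    unfolding circular_chromatic_number_def using col by (intro cInf_greatest) auto
  moreover have "0 < 1 / real ?N"
    using N by simp
  ultimately show ?thesis
    by linarith
qed

lemma circular_chromatic_number_le:
  assumes "p > 0" "q > 0" "pq_coloring G p q c"
  shows "circular_chromatic_number G \<le> real p / real q"
  unfolding circular_chromatic_number_def
proof (rule cInf_lower)
  show "bdd_below {real p / real q |p q. p > 0 \<and> q > 0 \<and> (\<exists>c. pq_coloring G p q c)}"
    by (rule bdd_belowI[of _ 0]) auto
qed (use assms in blast)

lemma pq_coloring_1:
  assumes "parcs G \<subseteq> pverts G \<times> pverts G" "proper_coloring G m c"
  shows "pq_coloring G m 1 c"
proof -
  have range: "1 \<le> c v" "c v \<le> m" if "v \<in> pverts G" for v
    using assms(2) that by (auto simp: proper_coloring_def)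
  have "int 1 \<le> \<bar>int (c u) - int (c v)\<bar> \<and> \<bar>int (c u) - int (c v)\<bar> \<le> int m - int 1"
    if "(u, v) \<in> parcs G" for u v
  proof -
    have "u \<in> pverts G" "v \<in> pverts G" "c u \<noteq> c v"
      using assms that by (auto simp: proper_coloring_def)
    then show ?thesis
      using range[of u] range[of v] by linarith
  qed
  then show ?thesis
    using range by (auto simp: pq_coloring_def)
qed

subsection \<open>Colorings of Schrijver graphs\<close>

text \<open>The only vertex avoiding \<^term>\<open>{1..d + 1}\<close> when \<^term>\<open>n = 2 * k + d\<close>.\<close>

definition base_vertex :: "nat \<Rightarrow> nat \<Rightarrow> nat set" where
  "base_vertex k d = (\<lambda>i. d + 2 + 2 * i) ` {..<k}"

lemma card_base_vertex: "card (base_vertex k d) = k"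
  unfolding base_vertex_def by (subst card_image) (auto simp: inj_on_def)

lemma Min_base_vertex: "k > 0 \<Longrightarrow> Min (base_vertex k d) = d + 2"
  by (rule Min_eqI) (force simp: base_vertex_def)+

text \<open>Cut the numbers from \<open>d + 2\<close> on into \<open>k\<close> consecutive pairs,
  the last reaching beyond the range. Each pair holds exactly one element, in the last one the
  lower, and this propagates downwards.\<close>

lemma eq_base_vertex:
  assumes S: "S \<in> schrijver_vertices (2 * k + d) k" and low: "\<And>x. x \<in> S \<Longrightarrow> d + 2 \<le> x"
  shows "S = base_vertex k d"
proof -
  have fin: "finite S" and card: "card S = k"
    using S by (auto simp: schrijver_vertices_def intro: finite_subset)
  have high: "x \<le> 2 * k + d" if "x \<in> S" for x
    using S that by (auto simp: schrijver_vertices_def)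
  have gap: "Suc x \<notin> S" if "x \<in> S" for x
    using S that low[OF that] high[of "Suc x"] by (auto simp: schrijver_vertices_def)
  define f where "f x = (x - (d + 2)) div 2" for x
  have f: "x = d + 2 + 2 * f x \<or> x = Suc (d + 2 + 2 * f x)" if "x \<in> S" for x
    using low[OF that] by (auto simp: f_def)
  have "inj_on f S"
  proof (rule inj_onI)
    fix x y assume xy: "x \<in> S" "y \<in> S" "f x = f y"
    then have "x = y \<or> y = Suc x \<or> x = Suc y"
      using f[of x] f[of y] by auto
    then show "x = y"
      using gap xy by blast
  qed
  moreover have "f x < k" if "x \<in> S" for x
    using low[OF that] high[OF that] by (auto simp: f_def)
  ultimately have image: "f ` S = {..<k}"
    using card by (intro card_subset_eq) (auto simp: card_image)
  have "d + 2 + 2 * j \<in> S" if "j < k" for j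
    using that
  \<comment> \<open>The upper element of pair \<open>j\<close> would be adjacent to the lower
    element of pair \<open>j + 1\<close>, already known to lie in \<open>S\<close>.\<close>
  proof (induction "k - j" arbitrary: j)
    case (Suc m)
    obtain x where x: "x \<in> S" "f x = j"
      using Suc.prems image by (metis imageE lessThan_iff)
    have "x \<noteq> Suc (d + 2 + 2 * j)"
    proof
      assume eq: "x = Suc (d + 2 + 2 * j)"
      then have "Suc j < k"
        using high[OF x(1)] Suc.prems by linarith
      then have "d + 2 + 2 * Suc j \<in> S"
        using Suc.hyps(1)[of "Suc j"] Suc.hyps(2) by simp
      then show False
        using gap[OF x(1)] eq by simp
    qed
    then show ?case
      using f[OF x(1)] x by auto
  qed simp
  then have "base_vertex k d \<subseteq> S"
    by (auto simp: base_vertex_def)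
  then show ?thesis
    using card_subset_eq[OF fin] card card_base_vertex by metis
qed

lemma abs_mult_diff_bounds:
  fixes w e k lo hi f :: int
  assumes "0 \<le> k" "lo \<le> \<bar>w\<bar>" "\<bar>w\<bar> \<le> hi" "\<bar>e\<bar> \<le> f"
  shows "lo * k - f \<le> \<bar>w * k - e\<bar>" "\<bar>w * k - e\<bar> \<le> hi * k + f"
proof -
  have "lo * k \<le> \<bar>w * k\<bar>" "\<bar>w * k\<bar> \<le> hi * k"
    using assms by (simp_all add: abs_mult mult_right_mono)
  then show "lo * k - f \<le> \<bar>w * k - e\<bar>" "\<bar>w * k - e\<bar> \<le> hi * k + f"
    using assms(4) by linarith+
qed

text \<open>The usual coloring of Kneser graphs by minima; for \<open>n = 2 * k + d\<close> only
  \<open>base_vertex k d\<close> gets the color \<open>d + 2\<close>.\<close>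

definition min_color :: "nat \<Rightarrow> nat set \<Rightarrow> nat" where
  "min_color d S = min (Min S) (d + 2)"

section \<open>Chromatic number, with \<open>d + 2\<close> in the role of \<open>t\<close>\<close>

context
  fixes n k d :: nat
  assumes n: "n = 2 * k + d" and k: "k > 0"
begin

lemma schrijver_verticesD:
  assumes "S \<in> schrijver_vertices n k"
  shows "finite S" "S \<noteq> {}" "card S = k" "S \<subseteq> {1..n}"
  using assms k by (auto simp: schrijver_vertices_def intro: finite_subset)

lemma min_color_top:
  assumes "S \<in> schrijver_vertices n k" "min_color d S = d + 2"
  shows "S = base_vertex k d"
proof (rule eq_base_vertex)
  show "S \<in> schrijver_vertices (2 * k + d) k"
    using assms n by simp
  show "d + 2 \<le> x" if "x \<in> S" for x
    using assms(2) Min_le[OF schrijver_verticesD(1)[OF assms(1)] that]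
    by (simp add: min_color_def min_def split: if_splits)
qed

lemma min_color_range:
  assumes "S \<in> schrijver_vertices n k"
  shows "min_color d S \<in> {1..d + 2}"
  using schrijver_verticesD[OF assms] Min_in[of S] by (auto simp: min_color_def)

lemma min_color_neq:
  assumes "S \<in> schrijver_vertices n k" "T \<in> schrijver_vertices n k" "S \<inter> T = {}"
  shows "min_color d S \<noteq> min_color d T"
proof
  assume eq: "min_color d S = min_color d T"
  show False
  proof (cases "min_color d S = d + 2")
    case True
    then have "S = T"
      using min_color_top assms eq by metis
    then show False
      using assms schrijver_verticesD(2) by blast
  next
    case False
    then have "Min S = Min T"
      using eq by (simp add: min_color_def min_def split: if_splits)
    then show False
      using assms Min_in[of S] Min_in[of T] schrijver_verticesD by (metis disjoint_iff)
  qed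
qed

lemma proper_min_color: "proper_coloring (schrijver_graph n k) (d + 2) (min_color d)"
  using min_color_range min_color_neq by (auto simp: proper_coloring_def schrijver_graph_def)

lemma schrijver_not_colorable: "\<not> proper_coloring (schrijver_graph n k) (d + 1) c"
  using schrijver_lower_bound[OF k, of "d + 1" n c] n by auto

text \<open>An empty graph would be properly colored by any map.\<close>

lemma schrijver_vertices_nonempty: "schrijver_vertices n k \<noteq> {}"
  using schrijver_not_colorable by (auto simp: proper_coloring_def schrijver_graph_def)

lemma chromatic_number_schrijver_graph: "chromatic_number (schrijver_graph n k) = d + 2"
  unfolding chromatic_number_def
proof (rule Least_equality)
  show "\<exists>c. proper_coloring (schrijver_graph n k) (d + 2) c"
    using proper_min_color by blast
  show "d + 2 \<le> m" if "\<exists>c. proper_coloring (schrijver_graph n k) m c" for m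
  proof (rule ccontr)
    assume "\<not> d + 2 \<le> m"
    then have "{1..m} \<subseteq> {1..d + 1}"
      by auto
    then have "\<exists>c. proper_coloring (schrijver_graph n k) (d + 1) c"
      using that unfolding proper_coloring_def by blast
    then show False
      using schrijver_not_colorable by blast
  qed
qed

section \<open>Positions on a circle of length \<open>(d + 1) * k\<close>\<close>

definition height :: "nat set \<Rightarrow> int" where
  "height S = int k - 2 * int (card (S \<inter> base_vertex k d))"

text \<open>A disjoint vertex \<^term>\<open>T\<close> has height close to \<^term>\<open>- height S\<close>. The
  colors \<^term>\<open>u\<close> are placed on the circle at distance \<^term>\<open>k\<close>; as the height grows from
  \<^term>\<open>- k\<close> to \<^term>\<open>0\<close>, the odd ones move from \<^term>\<open>(u - 1) * k\<close> to \<^term>\<open>u * k\<close>, and as it grows on to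
  \<^term>\<open>k\<close>, the even ones move back. At both ends the points of all colors below the top one sit
  in pairs, which leaves room for the base vertex.\<close>

definition position :: "nat set \<Rightarrow> int" where
  "position S = int (min_color d S) * int k -
     (if even (min_color d S) then max 0 (height S) else max 0 (- height S))"

lemma base_vertex_subset: "base_vertex k d \<subseteq> {1..n}"
  using n by (auto simp: base_vertex_def)

lemma height_bounds:
  shows "- int k \<le> height S" and "height S \<le> int k"
proof -
  have "card (S \<inter> base_vertex k d) \<le> card (base_vertex k d)"
    by (rule card_mono) (auto simp: base_vertex_def)
  then show "- int k \<le> height S"
    by (simp add: height_def card_base_vertex)
qed (simp add: height_def)

text \<open>Keeps color 1 away from position 0, which is not a color of a circular coloring.\<close>

lemma height_neq:
  assumes "S \<in> schrijver_vertices n k" "S \<noteq> base_vertex k d"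
  shows "height S \<noteq> - int k"
proof
  assume "height S = - int k"
  then have *: "card (S \<inter> base_vertex k d) = k"
    by (simp add: height_def)
  have "S \<inter> base_vertex k d = S"
    using card_subset_eq[of S "S \<inter> base_vertex k d"] schrijver_verticesD[OF assms(1)] * by auto
  moreover have "S \<inter> base_vertex k d = base_vertex k d"
    using card_subset_eq[of "base_vertex k d" "S \<inter> base_vertex k d"] card_base_vertex[of k d] *
    by (auto simp: base_vertex_def)
  ultimately show False
    using assms(2) by simp
qed

text \<open>The sum is twice the number of points of the base vertex outside both sets, and only
  \<open>d\<close> points of \<open>{1..n}\<close> lie outside both.\<close>

lemma height_disjoint:
  assumes S: "S \<in> schrijver_vertices n k" and T: "T \<in> schrijver_vertices n k"
    and disj: "S \<inter> T = {}"
  shows "0 \<le> height S + height T" "height S + height T \<le> 2 * int d"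
proof -
  let ?B = "base_vertex k d"
  have finB: "finite ?B"
    by (simp add: base_vertex_def)
  have un: "card (S \<inter> ?B) + card (T \<inter> ?B) = card ((S \<union> T) \<inter> ?B)"
    using disj finB by (subst card_Un_disjoint[symmetric]) (auto simp: Int_Un_distrib2)
  have "card ((S \<union> T) \<inter> ?B) \<le> card ?B"
    by (rule card_mono[OF finB]) auto
  then show "0 \<le> height S + height T"
    using un card_base_vertex[of k d] by (simp add: height_def)
  have "card ?B = card ((S \<union> T) \<inter> ?B) + card (?B - (S \<union> T))"
    using finB by (subst card_Un_disjoint[symmetric]) (auto intro: arg_cong[of _ _ card])
  moreover have "card (?B - (S \<union> T)) \<le> card ({1..n} - (S \<union> T))"
    using base_vertex_subset by (intro card_mono) auto
  moreover have "card ({1..n} - (S \<union> T)) = n - card (S \<union> T)"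
    using schrijver_verticesD[OF S] schrijver_verticesD[OF T] by (subst card_Diff_subset) auto
  moreover have "card (S \<union> T) = 2 * k"
    using schrijver_verticesD[OF S] schrijver_verticesD[OF T] disj by (simp add: card_Un_disjoint)
  ultimately show "height S + height T \<le> 2 * int d"
    using un card_base_vertex[of k d] n by (simp add: height_def)
qed

lemma position_range:
  assumes S: "S \<in> schrijver_vertices n k" and "odd d"
  shows "1 \<le> position S" "position S \<le> int ((d + 1) * k)"
proof -
  let ?u = "min_color d S"
  have u: "1 \<le> ?u" "?u \<le> d + 2"
    using min_color_range[OF S] by auto
  note h = height_bounds(1)[of S] height_bounds(2)[of S]
  have *: "1 \<le> position S \<and> position S \<le> int ((d + 1) * k)"
  proof (cases "S = base_vertex k d")
    case True
    then have "?u = d + 2"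
      using Min_base_vertex[OF k] by (simp add: min_color_def)
    moreover have "height S = - int k"
      using True card_base_vertex by (simp add: height_def)
    ultimately have "position S = int ((d + 1) * k)"
      using \<open>odd d\<close> by (simp add: position_def algebra_simps)
    moreover have "1 \<le> (d + 1) * k"
      using k by simp
    ultimately show ?thesis
      by linarith
  next
    case False
    then have "?u \<noteq> d + 2"
      using min_color_top[OF S] by blast
    then have "?u * k \<le> (d + 1) * k"
      using u by (intro mult_right_mono) auto
    then have upper: "int ?u * int k \<le> int ((d + 1) * k)"
      by (metis of_nat_le_iff of_nat_mult)
    \<comment> \<open>An even color is at least 2 and can afford a shift by \<open>k\<close>; color
      1 cannot, but odd colors shift by less than \<open>k\<close> thanks to
      \<open>height_neq\<close>.\<close>
    have "(if even ?u then 2 else 1) \<le> int ?u"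
      using u by (auto elim!: evenE)
    then have lower: "(if even ?u then 2 else 1) * int k \<le> int ?u * int k"
      by (rule mult_right_mono) simp
    show ?thesis
    proof (cases "even ?u")
      case True
      then have "position S = int ?u * int k - max 0 (height S)"
        by (simp add: position_def)
      moreover have "2 * int k \<le> int ?u * int k"
        using lower True by simp
      ultimately show ?thesis
        using upper h k by linarith
    next
      case odd: False
      then have "position S = int ?u * int k - max 0 (- height S)"
        by (simp add: position_def)
      moreover have "1 * int k \<le> int ?u * int k"
        using lower odd by presburger
      ultimately show ?thesis
        using upper h height_neq[OF S False] k by linarith
    qed
  qed
  then show "1 \<le> position S" "position S \<le> int ((d + 1) * k)"
    by auto
qed

text \<open>A vertex disjoint from the base has height \<open>k\<close>, so even colors have moved
  back onto odd ones and all positions are odd multiples of \<open>k\<close> up to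
  \<open>d * k\<close>. The base vertex sits at \<open>(d + 1) * k\<close>.\<close>

lemma position_diff_base_vertex:
  assumes T: "T \<in> schrijver_vertices n k" "base_vertex k d \<inter> T = {}" and "odd d"
  shows "int k \<le> position (base_vertex k d) - position T"
    "position (base_vertex k d) - position T \<le> int d * int k"
proof -
  let ?v = "min_color d T"
  have base: "position (base_vertex k d) = (int d + 1) * int k"
    using Min_base_vertex[OF k] card_base_vertex \<open>odd d\<close>
    by (simp add: position_def min_color_def height_def algebra_simps)
  have "T \<noteq> base_vertex k d"
    using T schrijver_verticesD(2)[OF T(1)] by auto
  then have "?v \<noteq> d + 2"
    using min_color_top[OF T(1)] by blast
  then have v: "1 \<le> ?v" "?v \<le> d + 1"
    using min_color_range[OF T(1)] by auto
  have "height T = int k"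
    using T(2) by (simp add: height_def Int_commute)
  then have pos: "position T = (int ?v - (if even ?v then 1 else 0)) * int k"
    by (simp add: position_def algebra_simps)
  define w where "w = int ?v - (if even ?v then 1 else 0)"
  have w: "1 \<le> w" "w \<le> int d"
    using v \<open>odd d\<close> by (cases "even ?v"; simp add: w_def; presburger)+
  have "1 * int k \<le> (int d + 1 - w) * int k" "(int d + 1 - w) * int k \<le> int d * int k"
    using w by (intro mult_right_mono; simp)+
  then show "int k \<le> position (base_vertex k d) - position T"
    "position (base_vertex k d) - position T \<le> int d * int k"
    unfolding base pos w_def[symmetric] by (simp_all add: algebra_simps)
qed

lemma position_diff:
  assumes S: "S \<in> schrijver_vertices n k" and T: "T \<in> schrijver_vertices n k"
    and disj: "S \<inter> T = {}" and "odd d"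
  shows "int k - 2 * int d \<le> \<bar>position S - position T\<bar>"
    "\<bar>position S - position T\<bar> \<le> int d * int k + 2 * int d"
proof -
  let ?B = "base_vertex k d"
  have "int k - 2 * int d \<le> \<bar>position S - position T\<bar> \<and>
    \<bar>position S - position T\<bar> \<le> int d * int k + 2 * int d"
  proof (cases "S = ?B \<or> T = ?B")
    case True
    then show ?thesis
      using position_diff_base_vertex[OF S _ \<open>odd d\<close>] position_diff_base_vertex[OF T _ \<open>odd d\<close>] disj
      by (auto simp: Int_commute)
  next
    case False
    define u v where "u = int (min_color d S)" and "v = int (min_color d T)"
    define e where "e X = (if even (min_color d X) then max 0 (height X) else max 0 (- height X))"
      for X
    have diff: "position S - position T = (u - v) * int k - (e S - e T)"
      by (simp add: position_def u_def v_def e_def algebra_simps)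
    have "min_color d S \<noteq> d + 2" "min_color d T \<noteq> d + 2"
      using False min_color_top[OF S] min_color_top[OF T] by auto
    then have range: "1 \<le> u" "u \<le> int d + 1" "1 \<le> v" "v \<le> int d + 1"
      using min_color_range[OF S] min_color_range[OF T] by (auto simp: u_def v_def)
    have neq: "u \<noteq> v"
      using min_color_neq[OF S T disj] by (simp add: u_def v_def)
    note h = height_disjoint[OF S T disj]
    note hS = height_bounds(1)[of S] height_bounds(2)[of S]
    note hT = height_bounds(1)[of T] height_bounds(2)[of T]
    show ?thesis
    proof (cases "even u = even v")
      case True
      \<comment> \<open>As \<open>d\<close> is odd, the extreme colors 1 and \<open>d + 1\<close>
        have different parity; this saves one step above as well as below, which pays for shifts of
        up to \<open>k\<close>.\<close>
      have "2 \<le> \<bar>u - v\<bar>" "\<bar>u - v\<bar> \<le> int d - 1"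
        using True neq range \<open>odd d\<close> by presburger+
      moreover have "\<bar>e S - e T\<bar> \<le> int k"
        using hS hT by (auto simp: e_def)
      ultimately have "2 * int k - int k \<le> \<bar>(u - v) * int k - (e S - e T)\<bar>"
        "\<bar>(u - v) * int k - (e S - e T)\<bar> \<le> (int d - 1) * int k + int k"
        using abs_mult_diff_bounds[of "int k" 2 "u - v" "int d - 1" "e S - e T" "int k"] by simp_all
      then show ?thesis
        unfolding diff by (simp add: algebra_simps)
    next
      case par: False
      have "1 \<le> \<bar>u - v\<bar>" "\<bar>u - v\<bar> \<le> int d"
        using neq range by linarith+
      \<comment> \<open>Colors of different parity shift by the positive parts of the height and of
        its negative, and the heights are opposite up to \<open>2 * d\<close>.\<close>
      moreover have "\<bar>e S - e T\<bar> \<le> 2 * int d"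
        using h par by (auto simp: e_def u_def v_def)
      ultimately have "1 * int k - 2 * int d \<le> \<bar>(u - v) * int k - (e S - e T)\<bar>"
        "\<bar>(u - v) * int k - (e S - e T)\<bar> \<le> int d * int k + 2 * int d"
        using abs_mult_diff_bounds[of "int k" 1 "u - v" "int d" "e S - e T" "2 * int d"] by simp_all
      then show ?thesis
        unfolding diff by simp
    qed
  qed
  then show "int k - 2 * int d \<le> \<bar>position S - position T\<bar>"
    "\<bar>position S - position T\<bar> \<le> int d * int k + 2 * int d"
    by auto
qed

text \<open>The number of colors is the largest position; subtracting the guaranteed distance
  \<open>k - 2 * d\<close> leaves exactly the upper bound of \<open>position_diff\<close>.\<close>

lemma pq_coloring_schrijver_graph:
  assumes "odd d" "2 * d < k"
  shows "pq_coloring (schrijver_graph n k) ((d + 1) * k) (k - 2 * d) (nat \<circ> position)"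
  unfolding pq_coloring_def
proof (intro conjI ballI)
  fix S assume "S \<in> pverts (schrijver_graph n k)"
  then show "(nat \<circ> position) S \<in> {1..(d + 1) * k}"
    using position_range[OF _ assms(1), of S] by (simp add: schrijver_graph_def nat_le_iff le_nat_iff)
next
  fix a assume "a \<in> parcs (schrijver_graph n k)"
  then obtain S T where a: "a = (S, T)" "S \<in> schrijver_vertices n k" "T \<in> schrijver_vertices n k"
    "S \<inter> T = {}"
    by (auto simp: schrijver_graph_def)
  have int: "int (nat (position S)) = position S" "int (nat (position T)) = position T"
    using position_range(1)[OF _ assms(1)] a by force+
  have pq: "int ((d + 1) * k) - int (k - 2 * d) = int d * int k + 2 * int d"
    "int (k - 2 * d) = int k - 2 * int d"
    using assms(2) by (simp_all add: of_nat_diff algebra_simps)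
  show "case a of (u, v) \<Rightarrow> int (k - 2 * d) \<le> \<bar>int ((nat \<circ> position) u) - int ((nat \<circ> position) v)\<bar> \<and>
      \<bar>int ((nat \<circ> position) u) - int ((nat \<circ> position) v)\<bar> \<le> int ((d + 1) * k) - int (k - 2 * d)"
    using position_diff[OF a(2-4) assms(1)] unfolding a(1) prod.case comp_apply int pq(1)
    unfolding pq(2) by (rule conjI)
qed

section \<open>Bounds for the circular chromatic number\<close>

lemma circular_chromatic_number_schrijver_graph_lower:
  "real (d + 1) < circular_chromatic_number (schrijver_graph n k)"
proof (rule circular_chromatic_number_gt)
  have "schrijver_vertices n k \<subseteq> Pow {1..n}"
    by (auto simp: schrijver_vertices_def)
  then show "finite (pverts (schrijver_graph n k))"
    by (simp add: schrijver_graph_def finite_subset)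
  have arcs: "parcs (schrijver_graph n k) \<subseteq> pverts (schrijver_graph n k) \<times> pverts (schrijver_graph n k)"
    by (auto simp: schrijver_graph_def)
  show "pverts (schrijver_graph n k) \<noteq> {}"
    using schrijver_vertices_nonempty by (simp add: schrijver_graph_def)
  show "pq_coloring (schrijver_graph n k) (d + 2) 1 (min_color d)"
    by (rule pq_coloring_1[OF arcs proper_min_color])
qed (use schrijver_not_colorable in auto)

lemma circular_chromatic_number_schrijver_graph_upper:
  fixes \<epsilon> :: real
  assumes "odd d" "0 < \<epsilon>" and large: "real (d + 2) ^ 3 / \<epsilon> \<le> real n"
  shows "circular_chromatic_number (schrijver_graph n k) < real (d + 1) + \<epsilon>"
proof (cases "\<epsilon> \<le> 1")
  \<comment> \<open>For \<open>\<epsilon> > 1\<close> the proper coloring with \<open>d + 2\<close>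
    colors suffices.\<close>
  case False
  have "parcs (schrijver_graph n k) \<subseteq> pverts (schrijver_graph n k) \<times> pverts (schrijver_graph n k)"
    by (auto simp: schrijver_graph_def)
  from circular_chromatic_number_le[OF _ _ pq_coloring_1[OF this proper_min_color]]
  show ?thesis
    using False by simp
next
  case True
  define D K where "D = real d" and "K = real k"
  have D: "1 \<le> D"
    using \<open>odd d\<close> by (auto simp: D_def elim: oddE)
  have "(D + 2) ^ 3 \<le> \<epsilon> * (2 * K + D)"
    using large assms(2) by (simp add: D_def K_def n field_simps)
  moreover have "\<epsilon> * (2 * K + D) = 2 * (\<epsilon> * K) + \<epsilon> * D"
    by (simp add: algebra_simps)
  moreover have "\<epsilon> * D \<le> 1 * D"
    using True D by (intro mult_right_mono) auto
  \<comment> \<open>Splits off twice the target \<open>2 * D * (D + 2)\<close>; the rest exceeds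
    \<open>D\<close>, which bounds the term \<open>\<epsilon> * D\<close> coming from
    \<open>n = 2 * k + d\<close>.\<close>
  moreover have "(D + 2) ^ 3 = 2 * (2 * D * (D + 2)) + (D ^ 3 + 2 * D ^ 2 + 4 * D + 8)"
    by (simp add: power3_eq_cube power2_eq_square algebra_simps)
  moreover have "0 \<le> D ^ 3" "0 \<le> D ^ 2"
    using D by auto
  ultimately have 1: "2 * D * (D + 2) < \<epsilon> * K"
    using D by linarith
  moreover have "2 * D * (D + 1 + \<epsilon>) \<le> 2 * D * (D + 2)"
    using True D by (intro mult_left_mono) auto
  \<comment> \<open>This is \<open>(D + 1) * K / (K - 2 * D) < D + 1 + \<epsilon>\<close> with the
    denominator cleared.\<close>
  ultimately have key: "2 * D * (D + 1 + \<epsilon>) < \<epsilon> * K"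
    by linarith
  have "2 * D * 1 \<le> 2 * D * (D + 2)"
    using D by (intro mult_left_mono) auto
  moreover have "\<epsilon> * K \<le> 1 * K"
    using True by (intro mult_right_mono) (auto simp: K_def)
  ultimately have "2 * D < K"
    using 1 by linarith
  then have dk: "2 * d < k"
    unfolding D_def K_def by linarith
  have "circular_chromatic_number (schrijver_graph n k) \<le> real ((d + 1) * k) / real (k - 2 * d)"
    by (rule circular_chromatic_number_le[OF _ _ pq_coloring_schrijver_graph[OF assms(1) dk]])
      (use dk k in auto)
  also have "\<dots> = (D + 1) * K / (K - 2 * D)"
    using dk by (simp add: D_def K_def of_nat_diff algebra_simps)
  also have "\<dots> < D + 1 + \<epsilon>"
    using key \<open>2 * D < K\<close> by (simp add: pos_divide_less_eq algebra_simps)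
  finally show ?thesis
    by (simp add: D_def)
qed

end

theorem theorem5p5:
  fixes \<epsilon> :: real and t n k :: nat
  assumes "\<epsilon> > 0"
    and "t \<ge> 3" and "odd t"
    and "n > 0" and "k > 0"
    and "int t = int n - 2 * int k + 2"
    and "real n \<ge> real t ^ 3 / \<epsilon>"
  shows "1 - \<epsilon> < real (chromatic_number (schrijver_graph n k))
                    - circular_chromatic_number (schrijver_graph n k)
       \<and> real (chromatic_number (schrijver_graph n k))
           - circular_chromatic_number (schrijver_graph n k) < 1"
proof -
  define d where "d = t - 2"
  have t: "t = d + 2" and d: "odd d" and n: "n = 2 * k + d"
    using assms(2,3,6) by (auto simp: d_def)
  show ?thesis
    using chromatic_number_schrijver_graph[OF n \<open>k > 0\<close>]
      circular_chromatic_number_schrijver_graph_lower[OF n \<open>k > 0\<close>]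
      circular_chromatic_number_schrijver_graph_upper[OF n \<open>k > 0\<close> d \<open>\<epsilon> > 0\<close>] assms(7)
    by (simp add: t)
qed

end
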